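(* For any two (finite, simple) graphs $G$ and $H$, $$\Gamma_3(G \oplus H) \cong \Gamma_3(G) \oplus \Gamma_3(H) \oplus (\Gamma_2(G) \square H) \oplus (\Gamma_2(H) \square G).$$
   Context: All graphs are finite, simple and undirected. For a graph $G$ and a natural number $k$, the $k$-token graph $\Gamma_k(G)$ has as vertex set the collection of all $k$-element subsets of $V(G)$ (it is the graph with no vertices if $|V(G)|<k$), and two distinct $k$-subsets $A,B$ are adjacent if and only if $A \triangle B = \{x,y\}$ with $xy \in E(G)$. $G \oplus H$ denotes the disjoint union of $G$ and $H$, and $G \square H$ denotes the Cartesian product: vertex set $V(G)\times V(H)$, with $(g,h)$ adjacent to $(g',h')$ iff either $g=g'$ and $hh' \in E(H)$, or $h=h'$ and $gg'\in E(G)$. *)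

theory Defs
  imports "Graph_Theory.Graph_Theory" "HOL-Library.Ramsey"
begin

text \<open>
  Finite simple undirected graphs are the records satisfying \<open>pair_graph\<close>: each edge \<open>xy\<close> is
  represented by the two arcs \<open>(x, y)\<close> and \<open>(y, x)\<close>. The type of the vertices is arbitrary
  and the vertex set may be empty.
\<close>

definition token_graph :: "nat \<Rightarrow> 'a pair_pre_digraph \<Rightarrow> 'a set pair_pre_digraph" where
  "token_graph k G =
    \<lparr> pverts = nsets (pverts G) k,
      parcs = {(A, B). A \<in> nsets (pverts G) k \<and> B \<in> nsets (pverts G) k \<and> A \<noteq> B \<and>
        (\<exists>x y. (x, y) \<in> parcs G \<and> sym_diff A B = {x, y})} \<rparr>"

definition disjoint_union ::
    "'a pair_pre_digraph \<Rightarrow> 'b pair_pre_digraph \<Rightarrow> ('a + 'b) pair_pre_digraph"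
    (infixl "\<oplus>" 65) where
  "G \<oplus> H =
    \<lparr> pverts = pverts G <+> pverts H,
      parcs = {(Inl g, Inl g') | g g'. (g, g') \<in> parcs G} \<union>
              {(Inr h, Inr h') | h h'. (h, h') \<in> parcs H} \<rparr>"

definition cartesian_product ::
    "'a pair_pre_digraph \<Rightarrow> 'b pair_pre_digraph \<Rightarrow> ('a \<times> 'b) pair_pre_digraph"
    (infixl "\<box>" 70) where
  "G \<box> H =
    \<lparr> pverts = pverts G \<times> pverts H,
      parcs = {((g, h), (g', h')).
        (g, h) \<in> pverts G \<times> pverts H \<and> (g', h') \<in> pverts G \<times> pverts H \<and>
        (g = g' \<and> (h, h') \<in> parcs H \<or> h = h' \<and> (g, g') \<in> parcs G)} \<rparr>"

abbreviation graph_iso :: "'a pair_pre_digraph \<Rightarrow> 'b pair_pre_digraph \<Rightarrow> bool"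
    (infix "\<cong>" 50) where
  "G \<cong> H \<equiv> digraph_iso (with_proj G) (with_proj H)"

text \<open>
  On well-formed graphs, \<open>\<cong>\<close> is the usual notion of isomorphism: a bijection of the vertex sets
  that preserves and reflects adjacency.
\<close>

lemma graph_iso_iff:
  assumes "pair_wf_digraph G" and "pair_wf_digraph H"
  shows "G \<cong> H \<longleftrightarrow> (\<exists>f. bij_betw f (pverts G) (pverts H) \<and>
    (\<forall>u\<in>pverts G. \<forall>v\<in>pverts G. (u, v) \<in> parcs G \<longleftrightarrow> (f u, f v) \<in> parcs H))"
    (is "?L \<longleftrightarrow> ?R")
proof
  interpret G: pair_wf_digraph G by fact
  interpret H: pair_wf_digraph H by fact
  {
    assume ?L
    then obtain \<phi> where iso: "pre_digraph.digraph_isomorphism (with_proj G) \<phi>"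
      and H: "with_proj H = app_iso \<phi> (with_proj G)"
      unfolding digraph_iso_def by blast
    from H have V: "pverts H = iso_verts \<phi> ` pverts G"
      and E: "parcs H = iso_arcs \<phi> ` parcs G"
      and T: "iso_tail \<phi> = fst" and D: "iso_head \<phi> = snd"
      by (auto simp: with_proj_def app_iso_def)
    from iso have inj: "inj_on (iso_verts \<phi>) (pverts G)"
      and arcs: "\<And>u v. (u, v) \<in> parcs G \<Longrightarrow> iso_arcs \<phi> (u, v) = (iso_verts \<phi> u, iso_verts \<phi> v)"
      using T D by (auto simp: pre_digraph.digraph_isomorphism_def prod_eq_iff)
    have "(u, v) \<in> parcs G \<longleftrightarrow> (iso_verts \<phi> u, iso_verts \<phi> v) \<in> parcs H"
      if "u \<in> pverts G" "v \<in> pverts G" for u v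
    proof
      assume "(u, v) \<in> parcs G"
      then show "(iso_verts \<phi> u, iso_verts \<phi> v) \<in> parcs H"
        using arcs[of u v] unfolding E by (metis imageI)
    next
      assume "(iso_verts \<phi> u, iso_verts \<phi> v) \<in> parcs H"
      then obtain u' v' where "(u', v') \<in> parcs G"
        "iso_verts \<phi> u' = iso_verts \<phi> u" "iso_verts \<phi> v' = iso_verts \<phi> v"
        using arcs unfolding E by fastforce
      then show "(u, v) \<in> parcs G"
        using inj that G.wellformed' by (metis inj_onD)
    qed
    then show ?R
      using inj V by (auto simp: bij_betw_def)
  }
  {
    assume ?R
    then obtain f where bij: "bij_betw f (pverts G) (pverts H)"
      and adj: "\<And>u v. u \<in> pverts G \<Longrightarrow> v \<in> pverts G \<Longrightarrow>
        (u, v) \<in> parcs G \<longleftrightarrow> (f u, f v) \<in> parcs H"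
      by blast
    define \<phi> where "\<phi> = \<lparr> iso_verts = f, iso_arcs = map_prod f f,
      iso_head = snd :: 'b \<times> 'b \<Rightarrow> 'b, iso_tail = fst :: 'b \<times> 'b \<Rightarrow> 'b \<rparr>"
    have inj: "inj_on f (pverts G)" and V: "pverts H = f ` pverts G"
      using bij by (auto simp: bij_betw_def)
    have sub: "parcs G \<subseteq> pverts G \<times> pverts G"
      using G.wellformed' by auto
    have E: "parcs H = map_prod f f ` parcs G"
    proof (intro equalityI subsetI)
      fix e assume "e \<in> parcs H"
      moreover obtain a b where e: "e = (a, b)"
        by (cases e)
      ultimately have "a \<in> f ` pverts G" "b \<in> f ` pverts G"
        using H.wellformed' V by blast+
      then obtain u v where uv: "a = f u" "b = f v" "u \<in> pverts G" "v \<in> pverts G"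
        by blast
      then have "(u, v) \<in> parcs G"
        using \<open>e \<in> parcs H\<close> adj e by blast
      then have "map_prod f f (u, v) \<in> map_prod f f ` parcs G"
        by (rule imageI)
      then show "e \<in> map_prod f f ` parcs G"
        using e uv by simp
    next
      fix e assume "e \<in> map_prod f f ` parcs G"
      then obtain u v where "(u, v) \<in> parcs G" "e = (f u, f v)"
        by (metis imageE map_prod_simp surj_pair)
      then show "e \<in> parcs H"
        using adj sub by blast
    qed
    have "inj_on (map_prod f f) (parcs G)"
      using map_prod_inj_on[OF inj inj] sub by (rule inj_on_subset)
    then have "pre_digraph.digraph_isomorphism (with_proj G) \<phi>"
      using inj G.wf_digraph by (auto simp: pre_digraph.digraph_isomorphism_def \<phi>_def)
    moreover have "with_proj H = app_iso \<phi> (with_proj G)"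
      using V E by (simp add: with_proj_def app_iso_def \<phi>_def)
    ultimately show ?L
      unfolding digraph_iso_def by blast
  }
qed

lemma pair_graph_intro:
  assumes "finite (pverts G)" and "parcs G \<subseteq> pverts G \<times> pverts G"
    and "sym (parcs G)" and "irrefl (parcs G)"
  shows "pair_graph G"
proof -
  have "finite (parcs G)"
    using assms(1,2) by (meson finite_SigmaI finite_subset)
  then show ?thesis
    using assms by unfold_locales (auto simp: symmetric_def irrefl_def)
qed

lemma pair_graph_token_graph:
  assumes "pair_graph G"
  shows "pair_graph (token_graph k G)"
proof (rule pair_graph_intro)
  interpret pair_graph G by fact
  show "finite (pverts (token_graph k G))"
    by (simp add: token_graph_def finite_imp_finite_nsets)
  show "sym (parcs (token_graph k G))"
    by (auto simp: token_graph_def sym_def Un_commute)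
qed (auto simp: token_graph_def irrefl_def)

lemma pair_graph_disjoint_union:
  assumes "pair_graph G" and "pair_graph H"
  shows "pair_graph (G \<oplus> H)"
proof (rule pair_graph_intro)
  interpret G: pair_graph G by fact
  interpret H: pair_graph H by fact
  show "finite (pverts (G \<oplus> H))"
    by (simp add: disjoint_union_def)
  show "parcs (G \<oplus> H) \<subseteq> pverts (G \<oplus> H) \<times> pverts (G \<oplus> H)"
    by (auto simp: disjoint_union_def dest: G.wellformed' H.wellformed')
  show "sym (parcs (G \<oplus> H))"
    by (auto simp: disjoint_union_def sym_def dest: G.arcs_symmetric H.arcs_symmetric)
  show "irrefl (parcs (G \<oplus> H))"
    by (auto simp: disjoint_union_def irrefl_def dest: G.no_loops' H.no_loops')
qed

lemma pair_graph_cartesian_product: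
  assumes "pair_graph G" and "pair_graph H"
  shows "pair_graph (G \<box> H)"
proof (rule pair_graph_intro)
  interpret G: pair_graph G by fact
  interpret H: pair_graph H by fact
  show "finite (pverts (G \<box> H))"
    by (simp add: cartesian_product_def)
  show "sym (parcs (G \<box> H))"
    by (auto simp: cartesian_product_def sym_def dest: G.arcs_symmetric H.arcs_symmetric)
  show "irrefl (parcs (G \<box> H))"
    by (auto simp: cartesian_product_def irrefl_def dest: G.no_loops' H.no_loops')
qed (auto simp: cartesian_product_def)

end

theory Submission
  imports Defs
begin

text \<open>
  A 3-subset of the disjoint union of the vertex sets is \<open>A <+> B\<close> with \<open>(|A|, |B|)\<close> one of
  \<open>(3, 0)\<close>, \<open>(0, 3)\<close>, \<open>(2, 1)\<close>, \<open>(1, 2)\<close>. Moving a token along an edge changes only one of \<open>A\<close>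
  and \<open>B\<close> and preserves its size, so there are no edges between these four types. On the
  type \<open>(i, j)\<close> the adjacency is that of \<open>\<Gamma>\<^sub>i(G) \<box> \<Gamma>\<^sub>j(H)\<close>, where \<open>\<Gamma>\<^sub>0\<close> is a single vertex
  and \<open>\<Gamma>\<^sub>1(H) \<cong> H\<close>.
\<close>

lemma Plus_eq_iff: "A <+> B = A' <+> B' \<longleftrightarrow> A = A' \<and> B = B'"
  by (auto simp: Plus_def set_eq_iff image_iff)

lemma sym_diff_Plus: "sym_diff (A <+> B) (A' <+> B') = sym_diff A A' <+> sym_diff B B'"
  by auto

lemma Plus_eq_Inl_pair_iff: "A <+> B = {Inl x, Inl y} \<longleftrightarrow> A = {x, y} \<and> B = {}"
  using Plus_eq_iff[of A B "{x, y}" "{}"] by (simp add: Plus_def)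

lemma Plus_eq_Inr_pair_iff: "A <+> B = {Inr x, Inr y} \<longleftrightarrow> A = {} \<and> B = {x, y}"
  using Plus_eq_iff[of A B "{}" "{x, y}"] by (simp add: Plus_def)

text \<open>Finiteness of \<open>V\<close> and \<open>W\<close> passes to \<open>A\<close> and
  \<open>B\<close>, which makes \<open>card\<close> additive on \<open>A <+> B\<close>.\<close>

lemma Plus_in_nsets_iff:
  assumes "finite V" "finite W"
  shows "A <+> B \<in> nsets (V <+> W) k \<longleftrightarrow> A \<subseteq> V \<and> B \<subseteq> W \<and> card A + card B = k"
proof -
  have "A <+> B \<subseteq> V <+> W \<longleftrightarrow> A \<subseteq> V \<and> B \<subseteq> W"
    by (auto simp: subset_iff)
  moreover have "finite (A <+> B) \<and> card (A <+> B) = card A + card B"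
    if "A \<subseteq> V" "B \<subseteq> W"
    using finite_subset[OF that(1) assms(1)] finite_subset[OF that(2) assms(2)]
    by (simp add: card_Plus)
  ultimately show ?thesis
    unfolding nsets_def mem_Collect_eq by metis
qed

lemma pverts_token_graph: "pverts (token_graph k G) = nsets (pverts G) k"
  by (simp add: token_graph_def)

lemma arc_disjoint_union_iff:
  "(Inl g, Inl g') \<in> parcs (G \<oplus> H) \<longleftrightarrow> (g, g') \<in> parcs G"
  "(Inr h, Inr h') \<in> parcs (G \<oplus> H) \<longleftrightarrow> (h, h') \<in> parcs H"
  "(Inl g, Inr h) \<notin> parcs (G \<oplus> H)"
  "(Inr h, Inl g) \<notin> parcs (G \<oplus> H)"
  by (auto simp: disjoint_union_def)

lemma arc_cartesian_product_iff:
  "((g, h), (g', h')) \<in> parcs (G \<box> H) \<longleftrightarrow>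
    (g, h) \<in> pverts G \<times> pverts H \<and> (g', h') \<in> pverts G \<times> pverts H \<and>
    (g = g' \<and> (h, h') \<in> parcs H \<or> h = h' \<and> (g, g') \<in> parcs G)"
  by (simp add: cartesian_product_def)

text \<open>\<open>sym_diff\<close> acts separately on the two sides of \<open><+>\<close>, and both
  ends of an edge of \<open>G \<oplus> H\<close> lie on one side. So the symmetric difference is a
  pair on that side and empty on the other.\<close>

lemma token_arc_disjoint_union_iff:
  assumes "finite (pverts G)" "finite (pverts H)"
    and "A <+> B \<in> nsets (pverts (G \<oplus> H)) k" "A' <+> B' \<in> nsets (pverts (G \<oplus> H)) k"
  shows "(A <+> B, A' <+> B') \<in> parcs (token_graph k (G \<oplus> H)) \<longleftrightarrow>
    B = B' \<and> (A, A') \<in> parcs (token_graph (card A) G) \<or>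
    A = A' \<and> (B, B') \<in> parcs (token_graph (card B) H)"
    (is "?L \<longleftrightarrow> ?R")
proof -
  have V: "A \<subseteq> pverts G" "B \<subseteq> pverts H" "A' \<subseteq> pverts G" "B' \<subseteq> pverts H"
    "card A + card B = k" "card A' + card B' = k"
    using assms by (simp_all add: disjoint_union_def Plus_in_nsets_iff)
  then have fin: "finite A" "finite B" "finite A'" "finite B'"
    using assms(1,2) finite_subset by blast+
  have "?L \<longleftrightarrow> (A \<noteq> A' \<or> B \<noteq> B') \<and>
      ((\<exists>x y. (x, y) \<in> parcs G \<and> sym_diff A A' = {x, y} \<and> sym_diff B B' = {}) \<or>
       (\<exists>x y. (x, y) \<in> parcs H \<and> sym_diff B B' = {x, y} \<and> sym_diff A A' = {}))"
    using assms(3,4)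
    by (auto simp: token_graph_def disjoint_union_def Plus_eq_iff sym_diff_Plus
        Plus_eq_Inl_pair_iff Plus_eq_Inr_pair_iff) blast+
  \<comment> \<open>If \<open>B = B'\<close>, the common total \<open>k\<close> forces
    \<open>card A' = card A\<close>, so \<open>A'\<close> is also a vertex of
    \<open>token_graph (card A) G\<close>; likewise with the sides exchanged.\<close>
  also have "\<dots> \<longleftrightarrow> ?R"
    using V fin by (auto simp: token_graph_def nsets_def)
  finally show ?thesis .
qed

lemma token_graph_0_no_arcs: "parcs (token_graph 0 G) = {}"
  by (auto simp: token_graph_def)

text \<open>The pair \<open>{u, v}\<close> determines an arc only up to orientation, which symmetry
  of \<open>G\<close> absorbs; for \<open>u = v\<close> neither side has a loop. The index is
  \<open>Suc 0\<close> because \<open>card {h}\<close> simplifies to it.\<close>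

lemma token_graph_1_arc_iff:
  assumes "pair_graph G"
  shows "({u}, {v}) \<in> parcs (token_graph (Suc 0) G) \<longleftrightarrow> (u, v) \<in> parcs G"
proof -
  interpret pair_graph G by fact
  show ?thesis
  proof (cases "u = v")
    case True
    then show ?thesis
      using no_loops' by (auto simp: token_graph_def)
  next
    case False
    then have "sym_diff {u} {v} = {u, v}"
      by auto
    then have "(\<exists>x y. (x, y) \<in> parcs G \<and> sym_diff {u} {v} = {x, y}) \<longleftrightarrow> (u, v) \<in> parcs G"
      by (metis arcs_symmetric doubleton_eq_iff)
    then show ?thesis
      using False wellformed' by (auto simp: token_graph_def nsets_def)
  qed
qed

text \<open>Lets the isomorphism be given by its inverse: a map out of a nested sum is defined by
  pattern matching, whereas the forward map would have to split a set by its type.\<close>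

lemma graph_isoI_rev:
  assumes "pair_wf_digraph G" "pair_wf_digraph H" and bij: "bij_betw f (pverts H) (pverts G)"
    and adj: "\<And>u v. u \<in> pverts H \<Longrightarrow> v \<in> pverts H \<Longrightarrow>
      (f u, f v) \<in> parcs G \<longleftrightarrow> (u, v) \<in> parcs H"
  shows "G \<cong> H"
proof -
  let ?g = "inv_into (pverts H) f"
  have "(u, v) \<in> parcs G \<longleftrightarrow> (?g u, ?g v) \<in> parcs H"
    if "u \<in> pverts G" "v \<in> pverts G" for u v
    using adj[of "?g u" "?g v"] bij_betwE[OF bij_betw_inv_into[OF bij]] that
    by (simp add: bij_betw_inv_into_right[OF bij])
  then show ?thesis
    using bij_betw_inv_into[OF bij] graph_iso_iff[OF assms(1,2)] by blast
qed

text \<open>The nesting of \<open>Inl\<close> and \<open>Inr\<close> follows the left associativity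
  of \<open>\<oplus>\<close>.\<close>

fun join_tokens :: "(('a set + 'b set) + 'a set \<times> 'b) + 'b set \<times> 'a \<Rightarrow> ('a + 'b) set" where
  "join_tokens (Inl (Inl (Inl A))) = A <+> {}"
| "join_tokens (Inl (Inl (Inr B))) = {} <+> B"
| "join_tokens (Inl (Inr (A, h))) = A <+> {h}"
| "join_tokens (Inr (B, g)) = {g} <+> B"

theorem theorem1:
  fixes G :: "'a pair_pre_digraph" and H :: "'b pair_pre_digraph"
  assumes "pair_graph G" and "pair_graph H"
  shows "token_graph 3 (G \<oplus> H) \<cong>
    token_graph 3 G \<oplus> token_graph 3 H \<oplus> (token_graph 2 G \<box> H) \<oplus> (token_graph 2 H \<box> G)"
    (is "?L \<cong> ?R")
proof (rule graph_isoI_rev)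
  interpret G: pair_graph G by fact
  interpret H: pair_graph H by fact
  interpret L: pair_graph ?L
    by (intro pair_graph_token_graph pair_graph_disjoint_union assms)
  interpret R: pair_graph ?R
    by (intro pair_graph_token_graph pair_graph_disjoint_union pair_graph_cartesian_product assms)
  show "pair_wf_digraph ?L" "pair_wf_digraph ?R"
    by unfold_locales
  have vL: "pverts ?L = nsets (pverts (G \<oplus> H)) 3"
    by (rule pverts_token_graph)
  have vR: "pverts ?R = ((nsets (pverts G) 3 <+> nsets (pverts H) 3) <+>
      nsets (pverts G) 2 \<times> pverts H) <+> nsets (pverts H) 2 \<times> pverts G"
    by (simp add: pverts_token_graph disjoint_union_def cartesian_product_def)
  have maps: "join_tokens u \<in> pverts ?L" if "u \<in> pverts ?R" for u
    using that unfolding vL vR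
    by (auto simp: disjoint_union_def Plus_in_nsets_iff) (auto simp: nsets_def)
  show "bij_betw join_tokens (pverts ?R) (pverts ?L)"
    unfolding bij_betw_def
  proof (intro conjI equalityI subsetI)
    show "inj_on join_tokens (pverts ?R)"
      unfolding vR by (rule inj_onI) (auto simp: Plus_eq_iff nsets_def)
    show "X \<in> pverts ?L" if "X \<in> join_tokens ` pverts ?R" for X
      using that maps by blast
    show "X \<in> join_tokens ` pverts ?R" if X: "X \<in> pverts ?L" for X
    proof -
      define A where "A = Inl -` X"
      define B where "B = Inr -` X"
      have XAB: "X = A <+> B"
      proof (rule set_eqI)
        show "x \<in> X \<longleftrightarrow> x \<in> A <+> B" for x
          by (cases x) (auto simp: A_def B_def)
      qed
      then have AB: "A \<subseteq> pverts G" "B \<subseteq> pverts H" "card A + card B = 3"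
        using X unfolding vL by (simp_all add: disjoint_union_def Plus_in_nsets_iff)
      then have fin: "finite A" "finite B"
        using G.finite_verts H.finite_verts by (auto intro: finite_subset)
      consider "card A = 3" "B = {}" | "A = {}" "card B = 3"
        | h where "card A = 2" "B = {h}" | g where "A = {g}" "card B = 2"
      proof -
        have "card A = 3 \<and> card B = 0 \<or> card A = 0 \<and> card B = 3 \<or>
            card A = 2 \<and> card B = 1 \<or> card A = 1 \<and> card B = 2"
          using AB(3) by linarith
        then show ?thesis
          using that fin by (auto simp: card_1_singleton_iff)
      qed
      then show ?thesis
      proof cases
        case 1
        then have "Inl (Inl (Inl A)) \<in> pverts ?R" "X = join_tokens (Inl (Inl (Inl A)))"
          using XAB AB fin unfolding vR by (auto simp: nsets_def)
        then show ?thesis by blast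
      next
        case 2
        then have "Inl (Inl (Inr B)) \<in> pverts ?R" "X = join_tokens (Inl (Inl (Inr B)))"
          using XAB AB fin unfolding vR by (auto simp: nsets_def)
        then show ?thesis by blast
      next
        case (3 h)
        then have "Inl (Inr (A, h)) \<in> pverts ?R" "X = join_tokens (Inl (Inr (A, h)))"
          using XAB AB fin unfolding vR by (auto simp: nsets_def)
        then show ?thesis by blast
      next
        case (4 g)
        then have "Inr (B, g) \<in> pverts ?R" "X = join_tokens (Inr (B, g))"
          using XAB AB fin unfolding vR by (auto simp: nsets_def)
        then show ?thesis by blast
      qed
    qed
  qed
  show "(join_tokens u, join_tokens v) \<in> parcs ?L \<longleftrightarrow> (u, v) \<in> parcs ?R"
    if uv: "u \<in> pverts ?R" "v \<in> pverts ?R" for u v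
  proof -
    note arc = token_arc_disjoint_union_iff[OF G.finite_verts H.finite_verts]
    \<comment> \<open>The cardinalities are stated apart from \<open>nsets\<close> so that
      simplification can evaluate the index \<open>card A\<close> or \<open>card B\<close> in
      \<open>arc\<close>.\<close>
    have R_cases: thesis if "w \<in> pverts ?R"
      and "\<And>A. w = Inl (Inl (Inl A)) \<Longrightarrow> A \<in> nsets (pverts G) 3 \<Longrightarrow> card A = 3 \<Longrightarrow> thesis"
      and "\<And>B. w = Inl (Inl (Inr B)) \<Longrightarrow> B \<in> nsets (pverts H) 3 \<Longrightarrow> card B = 3 \<Longrightarrow> thesis"
      and "\<And>A h. w = Inl (Inr (A, h)) \<Longrightarrow> A \<in> nsets (pverts G) 2 \<Longrightarrow> h \<in> pverts H \<Longrightarrow>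
        card A = 2 \<Longrightarrow> thesis"
      and "\<And>B g. w = Inr (B, g) \<Longrightarrow> B \<in> nsets (pverts H) 2 \<Longrightarrow> g \<in> pverts G \<Longrightarrow>
        card B = 2 \<Longrightarrow> thesis" for w thesis
      using that(1) unfolding vR
      by (elim PlusE SigmaE) (simp_all add: that(2-5) nsets_def)
    \<comment> \<open>Sixteen cases. Two different types differ in the sizes of both parts, so
      neither equality in \<open>arc\<close> can hold. Within one type, an empty part contributes no
      arcs and a singleton part contributes the arcs of the original graph.\<close>
    show ?thesis
      using maps[OF uv(1)] maps[OF uv(2)] unfolding vL
      by - (rule R_cases[OF uv(1)]; rule R_cases[OF uv(2)];
        auto simp: arc token_graph_0_no_arcs token_graph_1_arc_iff assms
          arc_disjoint_union_iff arc_cartesian_product_iff pverts_token_graph)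
  qed
qed

end
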